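(* For any graph $G$, $\mathrm{gp}_{\mathrm g}'(G)=2$ if and only if $G\in\mathcal{H}$.
   Context: The family $\mathcal{H}$ consists of all graphs of order at least $2$ that are constructed in the following way. Let $G_i$, $1\le i\le k$, be a collection of $k\ge 0$ complete bipartite graphs $G_i=K_{2,n_i}$ with $n_i\ge 2$, and in each $G_i$ let the partite set with two vertices be $X_i=\{u_i,u_i'\}$ (if $n_i=2$, the choice of partite set is arbitrary). Identify all the vertices $u_i$, $1\le i\le k$, into a single vertex $u$ (if $k=0$, start from a single vertex $u$). Next, add a pendant path of arbitrary length (possibly $0$) to each of the vertices $u_i'$. Finally, attach an arbitrary number (possibly $0$) of paths at $u$ (each attached by an end). A set $S\subseteq V(G)$ is in general position if no shortest path of $G$ passes through more than two vertices of $S$. In the Builder-Blocker general position game on $G$, two players, Builder and Blocker, take it in turns to choose (mark) an unmarked vertex of $G$ so that at each stage the set of marked vertices is in general position; the game ends when no further vertex can be selected. Builder aims to make the final set of marked vertices as large as possible, Blocker as small as possible. In the B'-game Blocker moves first. $\mathrm{gp}_{\mathrm g}'(G)$ is the number of vertices in the final set when the B'-game is played optimally by both players.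
   Formalization: A graph on exactly two vertices is additionally assumed to be connected; this excludes only the graph of two isolated vertices, for which gp_g' = 2 although it is not in the family H, so the claim fails for it as stated. *)

theory Defs
  imports "Graph_Theory.Graph_Theory"
begin

text \<open>
  Finite simple graphs are the locale \<open>pair_graph\<close>: finite, loopless, symmetric digraphs without
  parallel arcs, an edge being a pair of opposite arcs.
\<close>

section \<open>General position\<close>

definition shortest_path :: "'a pair_pre_digraph \<Rightarrow> 'a list \<Rightarrow> bool" where
  "shortest_path G p \<longleftrightarrow> vpath p G \<and>
     (\<forall>q. vpath q G \<and> hd q = hd p \<and> last q = last p \<longrightarrow> vwalk_length p \<le> vwalk_length q)"

definition general_position :: "'a pair_pre_digraph \<Rightarrow> 'a set \<Rightarrow> bool" where
  "general_position G S \<longleftrightarrow> S \<subseteq> pverts G \<and> (\<forall>p. shortest_path G p \<longrightarrow> card (S \<inter> set p) \<le> 2)"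

section \<open>The Builder-Blocker game\<close>

datatype player = Builder | Blocker

fun opponent :: "player \<Rightarrow> player" where
  "opponent Builder = Blocker"
| "opponent Blocker = Builder"

definition legal_moves :: "'a pair_pre_digraph \<Rightarrow> 'a set \<Rightarrow> 'a set" where
  "legal_moves G S = {v \<in> pverts G - S. general_position G (insert v S)}"

text \<open>
  Minimax value of the position in which \<open>S\<close> is marked and \<open>P\<close> is to move: the size of the final
  set under optimal play from there on. The finiteness test only serves to make the recursion
  terminate for every argument.
\<close>

function game_value :: "'a pair_pre_digraph \<Rightarrow> player \<Rightarrow> 'a set \<Rightarrow> nat" where
  "game_value G P S =
     (if infinite (pverts G) \<or> legal_moves G S = {} then card S
      else (case P of Builder \<Rightarrow> Max | Blocker \<Rightarrow> Min)
             ((\<lambda>v. game_value G (opponent P) (insert v S)) ` legal_moves G S))"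
  by pat_completeness auto
termination
proof (relation "measure (\<lambda>(G, P, S). card (pverts G - S))", goal_cases)
  case 1
  show ?case by simp
next
  case (2 G P S v)
  then have "finite (pverts G - S)" "v \<in> pverts G - S"
    by (auto simp: legal_moves_def)
  moreover from this have "pverts G - insert v S \<subset> pverts G - S"
    by auto
  ultimately have "card (pverts G - insert v S) < card (pverts G - S)"
    by (intro psubset_card_mono)
  then show ?case
    by (simp only: in_measure prod.case)
qed

declare game_value.simps [simp del]

text \<open>The B'-game: Blocker starts with no vertex marked.\<close>

definition gp_game' :: "'a pair_pre_digraph \<Rightarrow> nat" where
  "gp_game' G = game_value G Blocker {}"

section \<open>The family H\<close>

definition complete_bipartite_on :: "'a set \<Rightarrow> 'a set \<Rightarrow> 'a pair_pre_digraph" where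
  "complete_bipartite_on X Y = \<lparr>pverts = X \<union> Y, parcs = X \<times> Y \<union> Y \<times> X\<rparr>"

definition path_graph :: "'a list \<Rightarrow> 'a pair_pre_digraph" where
  "path_graph xs = \<lparr>pverts = set xs, parcs = set (vwalk_arcs xs) \<union> (set (vwalk_arcs xs))\<inverse>\<rparr>"

text \<open>Overlapping vertices are identified.\<close>

definition graph_Union :: "'a pair_pre_digraph set \<Rightarrow> 'a pair_pre_digraph" where
  "graph_Union \<G> = \<lparr>pverts = (\<Union>G\<in>\<G>. pverts G), parcs = (\<Union>G\<in>\<G>. parcs G)\<rparr>"

text \<open>
  \<open>Hub\<close> is the vertex \<open>u\<close> into which all the \<open>u\<^sub>i\<close> are identified; \<open>Mid i j\<close> are the vertices of the
  second partite set of the \<open>i\<close>-th complete bipartite graph; \<open>Tail i t\<close> is the vertex at distance \<open>t\<close>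
  from \<open>u\<^sub>i'\<close> on the pendant path added to it, so that \<open>Tail i 0\<close> is \<open>u\<^sub>i'\<close> itself; \<open>Leg j t\<close> are the
  vertices other than \<open>u\<close> of the \<open>j\<close>-th path attached at \<open>u\<close>.
\<close>

datatype \<H>_vertex = Hub | Mid nat nat | Tail nat nat | Leg nat nat

text \<open>
  There are \<open>k\<close> complete bipartite graphs, the \<open>i\<close>-th with parts of sizes \<open>2\<close> and \<open>n i\<close> and a pendant
  path of length \<open>l i\<close>, and \<open>p\<close> paths attached at \<open>u\<close>, the \<open>j\<close>-th of length \<open>m j\<close>.
\<close>

definition \<H>_graph ::
  "nat \<Rightarrow> (nat \<Rightarrow> nat) \<Rightarrow> (nat \<Rightarrow> nat) \<Rightarrow> nat \<Rightarrow> (nat \<Rightarrow> nat) \<Rightarrow> \<H>_vertex pair_pre_digraph" where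
  "\<H>_graph k n l p m = graph_Union
     ({path_graph [Hub]}
      \<union> (\<lambda>i. complete_bipartite_on {Hub, Tail i 0} (Mid i ` {..<n i})) ` {..<k}
      \<union> (\<lambda>i. path_graph (map (Tail i) [0..<Suc (l i)])) ` {..<k}
      \<union> (\<lambda>j. path_graph (Hub # map (Leg j) [0..<m j])) ` {..<p})"

definition in_\<H> :: "'a pair_pre_digraph \<Rightarrow> bool" where
  "in_\<H> G \<longleftrightarrow> card (pverts G) \<ge> 2 \<and>
     (\<exists>k n l p m. (\<forall>i<k. n i \<ge> 2) \<and> digraph_iso (\<H>_graph k n l p m) G)"

lemma complete_bipartite_on_K:
  assumes "finite X" "finite Y" "X \<inter> Y = {}"
  shows "K\<^bsub>card X,card Y\<^esub> (with_proj (complete_bipartite_on X Y))"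
  using assms unfolding complete_bipartite_digraph_pair_def complete_bipartite_on_def
  by (intro conjI exI[of _ X] exI[of _ Y]) auto

end

theory Submission
  imports Defs
begin

text \<open>
  Any two vertices are in general position, so once the graph has two vertices the final set has at
  least two, and it has exactly two iff Blocker has a first move \<open>u\<close> after which every reply \<open>v\<close> of
  Builder ends the game. A third vertex \<open>w\<close> cannot be added iff \<open>u\<close>, \<open>v\<close>, \<open>w\<close> lie on a common
  shortest path. So the value is two iff some vertex \<open>u\<close> is collinear with every pair of other
  vertices (\<open>gp_game'_eq_2_iff_collinear\<close>), collinear meaning that one of the three distances is the
  sum of the other two.

  Suppose \<open>u\<close> is such a vertex, and call the distance from \<open>u\<close> the level. If \<open>x\<close> and \<open>y\<close> have levels
  \<open>i \<le> j\<close>, collinearity leaves only two possibilities: either \<open>d x y = i + j\<close>, with \<open>u\<close> in the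
  middle, or \<open>i < j\<close> and \<open>d x y = j - i\<close>, with \<open>x\<close> in the middle. Two vertices of the same level
  \<open>i\<close> are thus at distance \<open>2 * i\<close>; hence they are never adjacent, and have no common neighbour
  if \<open>i \<ge> 2\<close>. So from level two on each component of the graph without \<open>u\<close> is a path, and several
  vertices of level one can share a component only through a common neighbour of level two. With
  \<open>u\<close> put back, such a component is a pendant path or a \<open>K\<^sub>2\<^sub>,\<^sub>n\<close> with a path attached, which is how
  the graphs of the family are made.

  The locale \<open>branching\<close> expresses this shape by a level and a branch for each vertex, the arcs being
  exactly the pairs of consecutive levels within a branch or at the root. Because level and branch
  determine the arcs, an isomorphism is no more than a bijection that respects them
  (\<open>branching_arcs_eq\<close>), and a bijection onto a graph of the family is found by counting
  (\<open>bij_\<H>_graph\<close>). Conversely the distances in a branching structure, and so the collinearity of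
  all triples with the root, can be read off from levels and branches.
\<close>

section \<open>Distances and collinear triples\<close>

text \<open>Walks of length \<open>n\<close> are the pairs in \<open>E ^^ n\<close>; for unreachable pairs the value is arbitrary.\<close>

definition rdist :: "'a rel \<Rightarrow> 'a \<Rightarrow> 'a \<Rightarrow> nat" where
  "rdist E x y = (LEAST n. (x, y) \<in> E ^^ n)"

lemma rdist_le: "(x, y) \<in> E ^^ n \<Longrightarrow> rdist E x y \<le> n"
  unfolding rdist_def by (rule Least_le)

lemma rdist_relpow:
  assumes "(x, y) \<in> E\<^sup>*"
  shows "(x, y) \<in> E ^^ rdist E x y"
proof -
  obtain n where "(x, y) \<in> E ^^ n"
    using assms rtrancl_imp_relpow by blast
  then show ?thesis
    unfolding rdist_def by (rule LeastI)
qed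

lemma rdist_eqI:
  assumes "(x, y) \<in> E ^^ n" "\<And>m. (x, y) \<in> E ^^ m \<Longrightarrow> n \<le> m"
  shows "rdist E x y = n"
  unfolding rdist_def using assms by (rule Least_equality)

lemma relpow_trans: "(x, y) \<in> E ^^ a \<Longrightarrow> (y, z) \<in> E ^^ b \<Longrightarrow> (x, z) \<in> E ^^ (a + b)"
  by (auto simp: relpow_add)

lemma relpow_sym:
  assumes "sym E"
  shows "(x, y) \<in> E ^^ n \<longleftrightarrow> (y, x) \<in> E ^^ n"
proof -
  have "(y, x) \<in> E ^^ n" if "(x, y) \<in> E ^^ n" for x y
    using that
  proof (induction n arbitrary: y)
    case (Suc n)
    then obtain z where "(x, z) \<in> E ^^ n" "(z, y) \<in> E"
      by auto
    with Suc.IH assms show ?case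
      by (meson relpow_Suc_I2 symD)
  qed simp
  then show ?thesis by blast
qed

lemma rdist_commute: "sym E \<Longrightarrow> rdist E x y = rdist E y x"
  unfolding rdist_def by (simp add: relpow_sym)

text \<open>
  Lower bounds for distances come from this: a function that grows by at most one along each arc
  grows by at most \<open>n\<close> along a walk of length \<open>n\<close>.
\<close>

lemma relpow_potential_le:
  fixes \<phi> :: "'a \<Rightarrow> int"
  assumes "\<And>x y. (x, y) \<in> E \<Longrightarrow> \<phi> y \<le> \<phi> x + 1" and "(x, y) \<in> E ^^ n"
  shows "\<phi> y \<le> \<phi> x + int n"
  using assms(2)
proof (induction n arbitrary: y)
  case (Suc n)
  then obtain z where "(x, z) \<in> E ^^ n" "(z, y) \<in> E"
    by auto
  with Suc.IH[of z] assms(1)[of z y] show ?case by simp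
qed simp

text \<open>
  The two walks are required to exist, so that the arbitrary distance of an unreachable pair cannot
  make three vertices collinear.
\<close>

definition between :: "'a rel \<Rightarrow> 'a \<Rightarrow> 'a \<Rightarrow> 'a \<Rightarrow> bool" where
  "between E x y z \<longleftrightarrow> (\<exists>a b. (x, y) \<in> E ^^ a \<and> (y, z) \<in> E ^^ b \<and> rdist E x z = a + b)"

definition collinear :: "'a rel \<Rightarrow> 'a \<Rightarrow> 'a \<Rightarrow> 'a \<Rightarrow> bool" where
  "collinear E x y z \<longleftrightarrow> between E x y z \<or> between E y x z \<or> between E x z y"

lemma between_rdist:
  assumes "between E x y z"
  shows "rdist E x z = rdist E x y + rdist E y z"
proof -
  obtain a b where ab: "(x, y) \<in> E ^^ a" "(y, z) \<in> E ^^ b" "rdist E x z = a + b"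
    using assms by (auto simp: between_def)
  then have r: "(x, y) \<in> E\<^sup>*" "(y, z) \<in> E\<^sup>*"
    by (auto simp: relpow_imp_rtrancl)
  have "rdist E x z \<le> rdist E x y + rdist E y z"
    using r by (intro rdist_le relpow_trans) (auto intro: rdist_relpow)
  moreover have "rdist E x y \<le> a" "rdist E y z \<le> b"
    using ab by (auto intro: rdist_le)
  ultimately show ?thesis using ab(3) by simp
qed

lemma between_commute: "sym E \<Longrightarrow> between E x y z \<longleftrightarrow> between E z y x"
  unfolding between_def by (metis add.commute rdist_commute relpow_sym)

lemma collinear_reach:
  assumes "sym E" "collinear E x y z"
  shows "(x, y) \<in> E\<^sup>*"
proof -
  have "(a, b) \<in> E\<^sup>* \<and> (b, c) \<in> E\<^sup>*" if "between E a b c" for a b c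
    using that by (auto simp: between_def relpow_imp_rtrancl)
  moreover have "(a, b) \<in> E\<^sup>* \<Longrightarrow> (b, a) \<in> E\<^sup>*" for a b
    using assms(1) by (meson sym_rtrancl symD)
  ultimately show ?thesis
    using assms(2) unfolding collinear_def by (meson rtrancl_trans)
qed

section \<open>Shortest paths and general position\<close>

lemma vwalk_iff_nth:
  "vwalk p (with_proj G) \<longleftrightarrow>
     p \<noteq> [] \<and> set p \<subseteq> pverts G \<and> (\<forall>i. Suc i < length p \<longrightarrow> (p ! i, p ! Suc i) \<in> parcs G)"
proof -
  have "set (vwalk_arcs p) = {(p ! i, p ! Suc i) |i. Suc i < length p}"
  proof (induction p rule: vwalk_arcs.induct)
    case (3 x y xs)
    have "{((x # y # xs) ! i, (x # y # xs) ! Suc i) |i. Suc i < length (x # y # xs)}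
        = insert (x, y) {((y # xs) ! i, (y # xs) ! Suc i) |i. Suc i < length (y # xs)}" (is "?L = ?R")
    proof
      show "?L \<subseteq> ?R"
      proof
        fix e assume "e \<in> ?L"
        then obtain i where "e = ((x # y # xs) ! i, (x # y # xs) ! Suc i)" "Suc i < length (x # y # xs)"
          by blast
        then show "e \<in> ?R" by (cases i) auto
      qed
      show "?R \<subseteq> ?L" by force
    qed
    with 3 show ?case by simp
  qed auto
  then show ?thesis
    unfolding vwalk_def by auto
qed

lemma vwalk_relpow:
  assumes "vwalk p (with_proj G)" "i \<le> j" "j < length p"
  shows "(p ! i, p ! j) \<in> parcs G ^^ (j - i)"
  using assms(2,3)
proof (induction j rule: dec_induct)
  case (step j)
  then have "(p ! i, p ! j) \<in> parcs G ^^ (j - i)" "(p ! j, p ! Suc j) \<in> parcs G"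
    using assms(1) by (auto simp: vwalk_iff_nth)
  then show ?case
    using step.hyps by (simp add: Suc_diff_le) blast
qed simp

context pair_graph
begin

lemma sym_parcs: "sym (parcs G)"
  using arcs_symmetric by (auto intro: symI)

lemma relpow_vwalk:
  assumes "(x, y) \<in> parcs G ^^ n" "x \<in> pverts G"
  obtains p where "vwalk p (with_proj G)" "length p = Suc n" "p ! 0 = x" "p ! n = y"
proof -
  obtain f where f: "f 0 = x" "f n = y" "\<forall>i<n. (f i, f (Suc i)) \<in> parcs G"
    using assms(1) by (auto simp: relpow_fun_conv)
  have "f i \<in> pverts G" if "i \<le> n" for i
    using that f assms(2) by (cases i) (auto simp: Suc_le_eq dest: in_arcsD2)
  then have "vwalk (map f [0..<Suc n]) (with_proj G)"
    using f(3) by (auto simp: vwalk_iff_nth simp del: upt_Suc)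
  then show thesis
    using f by (intro that[of "map f [0..<Suc n]"]) (auto simp del: upt_Suc)
qed

text \<open>
  A repeated vertex could be short-cut, which would give a walk shorter than the distance.
\<close>

lemma vpath_of_length_rdist:
  assumes "vwalk p (with_proj G)" "length p = Suc (rdist (parcs G) (hd p) (last p))"
  shows "vpath p (with_proj G)"
proof
  let ?n = "length p"
  have ends: "hd p = p ! 0" "last p = p ! (?n - 1)"
    using assms(1) by (auto simp: vwalk_iff_nth hd_conv_nth last_conv_nth)
  have "p ! i \<noteq> p ! j" if "i < j" "j < ?n" for i j
  proof
    assume eq: "p ! i = p ! j"
    have "(p ! 0, p ! i) \<in> parcs G ^^ i" "(p ! i, p ! (?n - 1)) \<in> parcs G ^^ (?n - 1 - j)"
      using vwalk_relpow[OF assms(1), of 0 i] vwalk_relpow[OF assms(1), of j "?n - 1"] that eq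
      by auto
    from rdist_le[OF relpow_trans[OF this]]
    have "rdist (parcs G) (hd p) (last p) \<le> i + (?n - 1 - j)"
      unfolding ends .
    with that assms(2) show False by linarith
  qed
  then show "distinct p"
    unfolding distinct_conv_nth by (metis linorder_neqE_nat)
qed (rule assms(1))

text \<open>
  Shortest paths compete with paths, distances with walks; the two agree because a walk as short as
  the distance is already a path.
\<close>

lemma shortest_path_iff:
  "shortest_path G p \<longleftrightarrow>
     vwalk p (with_proj G) \<and> length p = Suc (rdist (parcs G) (hd p) (last p))"
proof -
  have bound: "rdist (parcs G) (hd q) (last q) \<le> length q - 1" if "vwalk q (with_proj G)" for q
  proof -
    have "hd q = q ! 0" "last q = q ! (length q - 1)" "q \<noteq> []"
      using that by (auto simp: vwalk_iff_nth hd_conv_nth last_conv_nth)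
    then show ?thesis
      using vwalk_relpow[OF that, of 0 "length q - 1"] by (auto intro: rdist_le)
  qed
  show ?thesis
  proof
    assume sp: "shortest_path G p"
    then have w: "vwalk p (with_proj G)"
      by (auto simp: shortest_path_def)
    then have p: "p \<noteq> []" "hd p \<in> pverts G" "hd p = p ! 0" "last p = p ! (length p - 1)"
      by (auto simp: vwalk_iff_nth hd_conv_nth last_conv_nth)
    then have "(hd p, last p) \<in> parcs G ^^ (length p - 1)"
      using vwalk_relpow[OF w, of 0 "length p - 1"] by simp
    then have "(hd p, last p) \<in> parcs G ^^ rdist (parcs G) (hd p) (last p)"
      by (intro rdist_relpow relpow_imp_rtrancl)
    from relpow_vwalk[OF this p(2)] obtain q where q: "vwalk q (with_proj G)"
      "length q = Suc (rdist (parcs G) (hd p) (last p))"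
      "q ! 0 = hd p" "q ! rdist (parcs G) (hd p) (last p) = last p" .
    then have e: "hd q = hd p" "last q = last p"
      by (auto simp: vwalk_iff_nth hd_conv_nth last_conv_nth)
    with q have "vpath q (with_proj G)"
      by (intro vpath_of_length_rdist) auto
    with sp e have "length p - 1 \<le> length q - 1"
      by (auto simp: shortest_path_def)
    with bound[OF w] q(2) p(1) have "length p = Suc (rdist (parcs G) (hd p) (last p))"
      by (cases p) auto
    with w show "vwalk p (with_proj G) \<and> length p = Suc (rdist (parcs G) (hd p) (last p))" ..
  next
    assume p: "vwalk p (with_proj G) \<and> length p = Suc (rdist (parcs G) (hd p) (last p))"
    then have "vpath p (with_proj G)"
      by (intro vpath_of_length_rdist) auto
    moreover have "length p - 1 \<le> length q - 1"
      if "vpath q (with_proj G)" "hd q = hd p" "last q = last p" for q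
      using that p bound[of q] by auto
    ultimately show "shortest_path G p"
      by (simp add: shortest_path_def)
  qed
qed

text \<open>
  A shorter walk from \<open>p ! i\<close> to \<open>p ! k\<close> could be spliced into \<open>p\<close>, so every segment of a shortest
  path is a shortest walk.
\<close>

lemma shortest_path_between:
  assumes "shortest_path G p" "i \<le> j" "j \<le> k" "k < length p"
  shows "between (parcs G) (p ! i) (p ! j) (p ! k)"
proof -
  let ?E = "parcs G" and ?n = "length p - 1"
  have w: "vwalk p (with_proj G)" and l': "length p = Suc (rdist ?E (hd p) (last p))"
    using assms(1) unfolding shortest_path_iff by blast+
  have "p \<noteq> []"
    using w by (simp add: vwalk_iff_nth)
  then have l: "length p = Suc (rdist ?E (p ! 0) (p ! ?n))"
    using l' by (metis hd_conv_nth last_conv_nth)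
  note walk = vwalk_relpow[OF w]
  have "k - i \<le> m" if "(p ! i, p ! k) \<in> ?E ^^ m" for m
  proof -
    have "(p ! 0, p ! i) \<in> ?E ^^ i" "(p ! k, p ! ?n) \<in> ?E ^^ (?n - k)"
      using walk[of 0 i] walk[of k ?n] assms(2-4) by auto
    from rdist_le[OF relpow_trans[OF relpow_trans[OF this(1) that] this(2)]]
    show ?thesis using l assms(2-4) by linarith
  qed
  moreover have "(p ! i, p ! k) \<in> ?E ^^ (k - i)"
    using assms(2-4) by (intro walk) auto
  ultimately have "rdist ?E (p ! i) (p ! k) = k - i"
    by (intro rdist_eqI)
  also have "\<dots> = (j - i) + (k - j)"
    using assms(2,3) by simp
  finally show ?thesis
    unfolding between_def using walk[of i j] walk[of j k] assms(2-4)
    by (meson le_less_trans)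
qed

text \<open>
  Two shortest walks joined at the middle vertex have the length of the distance of the outer
  vertices, so that the joined walk is a shortest path.
\<close>

lemma shortest_path_through:
  assumes "between (parcs G) x y z" "x \<in> pverts G"
  obtains p where "shortest_path G p" "{x, y, z} \<subseteq> set p"
proof -
  let ?E = "parcs G"
  obtain a b where ab: "(x, y) \<in> ?E ^^ a" "(y, z) \<in> ?E ^^ b" "rdist ?E x z = a + b"
    using assms(1) unfolding between_def by blast
  obtain f where f: "f 0 = x" "f a = y" "\<forall>i<a. (f i, f (Suc i)) \<in> ?E"
    using ab(1) by (auto simp: relpow_fun_conv)
  obtain g where g: "g 0 = y" "g b = z" "\<forall>i<b. (g i, g (Suc i)) \<in> ?E"
    using ab(2) by (auto simp: relpow_fun_conv)
  define h where "h i = (if i \<le> a then f i else g (i - a))" for i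
  have h: "h 0 = x" "h a = y" "h (a + b) = z"
    using f(1,2) g(1,2) by (auto simp: h_def)
  have arcs: "(h i, h (Suc i)) \<in> ?E" if "i < a + b" for i
  proof (cases "i < a")
    case False
    then have "h i = g (i - a)" "h (Suc i) = g (Suc (i - a))"
      using f(2) g(1) by (auto simp: h_def Suc_diff_le)
    with g(3) that False show ?thesis by auto
  qed (use f(3) in \<open>auto simp: h_def\<close>)
  have verts: "h i \<in> pverts G" if "i \<le> a + b" for i
    using that arcs h assms(2) by (cases i) (auto simp: Suc_le_eq dest: in_arcsD2)
  define p where "p = map h [0..<Suc (a + b)]"
  have "vwalk p (with_proj G)"
    using arcs verts by (auto simp: p_def vwalk_iff_nth simp del: upt_Suc)
  moreover have "length p = Suc (rdist ?E (hd p) (last p))"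
    using h ab(3) by (simp add: p_def hd_map last_map del: upt_Suc)
  ultimately have "shortest_path G p"
    by (simp add: shortest_path_iff)
  moreover have "h i \<in> set p" if "i \<le> a + b" for i
    using that by (auto simp: p_def simp del: upt_Suc)
  from this[of 0] this[of a] this[of "a + b"] have "{x, y, z} \<subseteq> set p"
    by (simp add: h)
  ultimately show thesis by (rule that)
qed

lemma general_position_small:
  assumes "S \<subseteq> pverts G" "card S \<le> 2"
  shows "general_position G S"
proof -
  have "card (S \<inter> set p) \<le> card S" for p
    using assms(1) by (intro card_mono) (auto intro: finite_subset[OF _ pair_finite_verts])
  with assms show ?thesis
    unfolding general_position_def using le_trans by blast
qed

lemma general_position_triple:
  assumes "{x, y, z} \<subseteq> pverts G" "x \<noteq> y" "x \<noteq> z" "y \<noteq> z"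
  shows "general_position G {x, y, z} \<longleftrightarrow> \<not> collinear (parcs G) x y z"
proof -
  have c3: "card {x, y, z} = 3"
    using assms by simp
  have triple: "card ({x, y, z} \<inter> set p) \<le> 2 \<longleftrightarrow> \<not> {x, y, z} \<subseteq> set p" for p
  proof
    assume small: "card ({x, y, z} \<inter> set p) \<le> 2"
    show "\<not> {x, y, z} \<subseteq> set p"
    proof
      assume "{x, y, z} \<subseteq> set p"
      then have "{x, y, z} \<inter> set p = {x, y, z}"
        by (rule Int_absorb2)
      with small c3 show False by simp
    qed
  next
    assume "\<not> {x, y, z} \<subseteq> set p"
    then have "{x, y, z} \<inter> set p \<subset> {x, y, z}" by blast
    then have "card ({x, y, z} \<inter> set p) < card {x, y, z}"
      by (intro psubset_card_mono) auto
    with c3 show "card ({x, y, z} \<inter> set p) \<le> 2" by simp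
  qed
  have "collinear (parcs G) x y z" if p: "shortest_path G p" "{x, y, z} \<subseteq> set p" for p
  proof -
    obtain i j k where ijk: "i < length p" "p ! i = x" "j < length p" "p ! j = y"
        "k < length p" "p ! k = z"
      using p(2) by (auto simp: in_set_conv_nth)
    note sb = shortest_path_between[OF p(1)]
    \<comment> \<open>The order of the positions on the path decides which vertex is in the middle.\<close>
    note flip = between_commute[OF sym_parcs]
    consider "i \<le> j" "j \<le> k" | "k \<le> j" "j \<le> i" | "j \<le> i" "i \<le> k" | "k \<le> i" "i \<le> j"
      | "i \<le> k" "k \<le> j" | "j \<le> k" "k \<le> i" by linarith
    then show ?thesis
    proof cases
      case 1
      from sb[OF this ijk(5)] show ?thesis unfolding collinear_def ijk by blast
    next
      case 2
      from sb[OF this ijk(1)] show ?thesis unfolding collinear_def ijk using flip by metis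
    next
      case 3
      from sb[OF this ijk(5)] show ?thesis unfolding collinear_def ijk by blast
    next
      case 4
      from sb[OF this ijk(3)] show ?thesis unfolding collinear_def ijk using flip by metis
    next
      case 5
      from sb[OF this ijk(3)] show ?thesis unfolding collinear_def ijk by blast
    next
      case 6
      from sb[OF this ijk(1)] show ?thesis unfolding collinear_def ijk using flip by metis
    qed
  qed
  moreover have "\<exists>p. shortest_path G p \<and> {x, y, z} \<subseteq> set p" if "collinear (parcs G) x y z"
  proof -
    have "\<exists>p. shortest_path G p \<and> {x, y, z} \<subseteq> set p"
      if abc: "between (parcs G) a b c" "{a, b, c} = {x, y, z}" for a b c
    proof -
      have "a \<in> pverts G" using abc(2) assms(1) by blast
      from shortest_path_through[OF abc(1) this]
      obtain p where "shortest_path G p" "{a, b, c} \<subseteq> set p" .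
      then show ?thesis using abc(2) by auto
    qed
    from this[of x y z] this[of y x z] this[of x z y] that show ?thesis
      unfolding collinear_def by blast
  qed
  ultimately show ?thesis
    unfolding general_position_def triple using assms(1) by blast
qed

section \<open>Games of value two\<close>

text \<open>
  Marked vertices stay marked, and whoever is to move must move if that is possible.
\<close>

lemma card_le_game_value: "S \<subseteq> pverts G \<Longrightarrow> card S \<le> game_value G P S"
  and card_less_game_value:
    "S \<subseteq> pverts G \<Longrightarrow> legal_moves G S \<noteq> {} \<Longrightarrow> card S < game_value G P S"
proof -
  have "card S + (if legal_moves G S = {} then 0 else 1) \<le> game_value G P S" if "S \<subseteq> pverts G" for S
    using that
  proof (induction "card (pverts G - S)" arbitrary: S P rule: less_induct)
    case less
    let ?vals = "(\<lambda>v. game_value G (opponent P) (insert v S)) ` legal_moves G S"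
    have fin: "finite S" "finite (legal_moves G S)"
      using less.prems pair_finite_verts by (auto intro: finite_subset simp: legal_moves_def)
    show ?case
    proof (cases "legal_moves G S = {}")
      case True
      then show ?thesis by (subst game_value.simps) simp
    next
      case False
      then have "Max ?vals \<in> ?vals" "Min ?vals \<in> ?vals"
        using fin by auto
      then have "game_value G P S \<in> ?vals"
        using False pair_finite_verts
        by (subst game_value.simps, cases P) simp_all
      then obtain v where v: "v \<in> legal_moves G S"
        "game_value G P S = game_value G (opponent P) (insert v S)"
        by blast
      then have "pverts G - insert v S \<subset> pverts G - S" "insert v S \<subseteq> pverts G"
        using less.prems by (auto simp: legal_moves_def)
      then have "card (pverts G - insert v S) < card (pverts G - S)" "insert v S \<subseteq> pverts G"
        using pair_finite_verts by (auto intro: psubset_card_mono)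
      from less.hyps[OF this, of "opponent P"] have "card (insert v S) \<le> game_value G P S"
        using v(2) by simp
      then show ?thesis
        using v(1) fin False by (simp add: legal_moves_def)
    qed
  qed
  from this[of S] show "S \<subseteq> pverts G \<Longrightarrow> card S \<le> game_value G P S"
    "S \<subseteq> pverts G \<Longrightarrow> legal_moves G S \<noteq> {} \<Longrightarrow> card S < game_value G P S"
    by (auto split: if_splits)
qed

text \<open>
  The first two moves are unrestricted, and every value after them is at least two. So Blocker's
  minimum over \<open>u\<close> is two iff for some \<open>u\<close> Builder's maximum over \<open>v\<close> is two, which means that all
  values after \<open>u\<close> and \<open>v\<close> are two, that is, the game is over.
\<close>

lemma gp_game'_eq_2_iff:
  "gp_game' G = 2 \<longleftrightarrow> card (pverts G) \<ge> 2 \<and>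
     (\<exists>u\<in>pverts G. \<forall>v\<in>pverts G - {u}. legal_moves G {u, v} = {})"
proof -
  let ?V = "pverts G"
  have legal0: "legal_moves G {} = ?V"
    by (auto simp: legal_moves_def intro!: general_position_small)
  have legal1: "legal_moves G {u} = ?V - {u}" if "u \<in> ?V" for u
    using that by (auto simp: legal_moves_def card_insert_if intro!: general_position_small)
  consider "card ?V = 0" | u where "?V = {u}" | "card ?V \<ge> 2"
    by (metis One_nat_def Suc_1 card_1_singletonE le_less_linear less_2_cases)
  then show ?thesis
  proof cases
    case 1
    then have "game_value G Blocker {} = 0"
      using legal0 pair_finite_verts by (subst game_value.simps) auto
    with 1 show ?thesis by (simp add: gp_game'_def)
  next
    case (2 u)
    then have "game_value G Builder {u} = 1"
      using legal1[of u] by (subst game_value.simps) auto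
    then have "game_value G Blocker {} = 1"
      using legal0 2 by (subst game_value.simps) auto
    with 2 show ?thesis by (simp add: gp_game'_def)
  next
    case 3
    have Blocker: "game_value G Blocker {u, v} \<ge> 2"
      "game_value G Blocker {u, v} = 2 \<longleftrightarrow> legal_moves G {u, v} = {}"
      if "u \<in> ?V" "v \<in> ?V - {u}" for u v
    proof -
      have c: "{u, v} \<subseteq> ?V" "card {u, v} = 2"
        using that by auto
      show "game_value G Blocker {u, v} \<ge> 2"
        using card_le_game_value[OF c(1)] c(2) by metis
      show "game_value G Blocker {u, v} = 2 \<longleftrightarrow> legal_moves G {u, v} = {}"
      proof
        assume "legal_moves G {u, v} = {}"
        then show "game_value G Blocker {u, v} = 2"
          using c(2) by (subst game_value.simps) simp
      next
        assume "game_value G Blocker {u, v} = 2"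
        then show "legal_moves G {u, v} = {}"
          using card_less_game_value[OF c(1), of Blocker] c(2) by auto
      qed
    qed
    have nonempty: "?V - {u} \<noteq> {}" for u
    proof
      assume "?V - {u} = {}"
      then have "?V \<subseteq> {u}" by blast
      then have "card ?V \<le> 1"
        using card_mono[of "{u}" ?V] by simp
      with 3 show False by simp
    qed
    have Builder: "game_value G Builder {u} \<ge> 2"
      "game_value G Builder {u} = 2 \<longleftrightarrow> (\<forall>v\<in>?V - {u}. legal_moves G {u, v} = {})"
      if u: "u \<in> ?V" for u
    proof -
      let ?vals = "(\<lambda>v. game_value G Blocker {u, v}) ` (?V - {u})"
      have val: "game_value G Builder {u} = Max ?vals"
        using nonempty[of u] pair_finite_verts legal1[OF u]
        by (subst game_value.simps) (simp add: insert_commute)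
      have fin: "finite ?vals" "?vals \<noteq> {}"
        using nonempty[of u] pair_finite_verts by auto
      have ge: "\<And>x. x \<in> ?vals \<Longrightarrow> 2 \<le> x"
        using Blocker(1)[OF u] by auto
      show "game_value G Builder {u} \<ge> 2"
        using Max_in[OF fin] ge val by simp
      have "Max ?vals = 2 \<longleftrightarrow> (\<forall>x\<in>?vals. x = 2)"
        using Max_in[OF fin] ge Max_ge[OF fin(1)] by (metis order_antisym)
      then show "game_value G Builder {u} = 2 \<longleftrightarrow> (\<forall>v\<in>?V - {u}. legal_moves G {u, v} = {})"
        using val Blocker(2)[OF u] by auto
    qed
    let ?vals = "(\<lambda>u. game_value G Builder {u}) ` ?V"
    have val: "gp_game' G = Min ?vals"
      using 3 pair_finite_verts legal0
      unfolding gp_game'_def by (subst game_value.simps) auto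
    have fin: "finite ?vals" "?vals \<noteq> {}"
      using 3 pair_finite_verts by auto
    have "\<And>x. x \<in> ?vals \<Longrightarrow> 2 \<le> x"
      using Builder(1) by auto
    then have "Min ?vals = 2 \<longleftrightarrow> 2 \<in> ?vals"
      using Min_in[OF fin] Min_le[OF fin(1)] by (metis order_antisym)
    then show ?thesis
      using val Builder(2) 3 by fastforce
  qed
qed

lemma gp_game'_eq_2_iff_collinear:
  "gp_game' G = 2 \<longleftrightarrow> card (pverts G) \<ge> 2 \<and>
     (\<exists>u\<in>pverts G. \<forall>v\<in>pverts G - {u}. \<forall>w\<in>pverts G - {u, v}. collinear (parcs G) u v w)"
proof -
  have "legal_moves G {u, v} = {} \<longleftrightarrow> (\<forall>w\<in>pverts G - {u, v}. collinear (parcs G) u v w)"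
    if "u \<in> pverts G" "v \<in> pverts G - {u}" for u v
  proof -
    have "general_position G (insert w {u, v}) \<longleftrightarrow> \<not> collinear (parcs G) u v w"
      if w: "w \<in> pverts G - {u, v}" for w
    proof -
      have "insert w {u, v} = {u, v, w}" by blast
      then show ?thesis
        using general_position_triple[of u v w] w \<open>u \<in> pverts G\<close> \<open>v \<in> pverts G - {u}\<close> by auto
    qed
    then show ?thesis
      unfolding legal_moves_def by auto
  qed
  then show ?thesis
    unfolding gp_game'_eq_2_iff by (intro conj_cong bex_cong ball_cong refl) auto
qed

end

section \<open>Branching structures\<close>

text \<open>
  \<open>lev\<close> is the distance from the root \<open>u\<close>, and the branches are the components that remain when \<open>u\<close>
  is removed. The axiom \<open>thin\<close> says that a level of a branch has a single vertex, except that the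
  first level may have several when the branch goes on to the second level. This last condition keeps the leaves attached to \<open>u\<close> in branches of their own.
\<close>

locale branching =
  fixes V :: "'a set" and E :: "'a rel" and u :: 'a and lev :: "'a \<Rightarrow> nat" and br :: "'a \<Rightarrow> 'b"
  assumes root: "u \<in> V"
    and lev_eq_0_iff: "x \<in> V \<Longrightarrow> lev x = 0 \<longleftrightarrow> x = u"
    and arc_iff: "(x, y) \<in> E \<longleftrightarrow> x \<in> V \<and> y \<in> V \<and> (lev y = Suc (lev x) \<or> lev x = Suc (lev y))
      \<and> (x = u \<or> y = u \<or> br x = br y)"
    and lower: "x \<in> V \<Longrightarrow> lev x = Suc (Suc n) \<Longrightarrow> \<exists>y\<in>V. lev y = Suc n \<and> br y = br x"
    and thin: "x \<in> V \<Longrightarrow> y \<in> V \<Longrightarrow> x \<noteq> y \<Longrightarrow> lev x = lev y \<Longrightarrow> br x = br y \<Longrightarrow>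
      lev x = 1 \<and> (\<exists>z\<in>V. br z = br x \<and> lev z = 2)"
begin

lemma sym_E: "sym E"
  by (auto intro!: symI simp: arc_iff)

lemma lev_root [simp]: "lev u = 0"
  using lev_eq_0_iff root by blast

lemma lev_lipschitz: "(x, y) \<in> E ^^ n \<Longrightarrow> lev y \<le> lev x + n"
proof -
  assume n: "(x, y) \<in> E ^^ n"
  have "int (lev b) \<le> int (lev a) + 1" if "(a, b) \<in> E" for a b
    using that by (auto simp: arc_iff)
  from relpow_potential_le[of E "\<lambda>x. int (lev x)", OF this n] show ?thesis by simp
qed

text \<open>
  Consecutive levels of a branch are completely joined, so a descent from \<open>y\<close> by \<open>lower\<close> can
  end at \<open>x\<close>.
\<close>

lemma relpow_climb:
  assumes "x \<in> V" "lev x \<noteq> 0" "y \<in> V" "br x = br y" "lev y = lev x + Suc n"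
  shows "(x, y) \<in> E ^^ Suc n"
  using assms(3-)
proof (induction n arbitrary: y)
  case 0
  then show ?case using assms by (auto simp: arc_iff)
next
  case (Suc n)
  then have "lev y = Suc (Suc (lev x + n))" by simp
  from lower[OF Suc.prems(1) this] obtain z where
    "z \<in> V" "lev z = lev x + Suc n" "br z = br y"
    by auto
  with Suc.IH[of z] Suc.prems have "(x, z) \<in> E ^^ Suc n" "(z, y) \<in> E"
    by (simp_all add: arc_iff)
  then show ?case by (rule relpow_Suc_I)
qed

lemma relpow_root: "x \<in> V \<Longrightarrow> (u, x) \<in> E ^^ lev x"
proof (induction "lev x" arbitrary: x rule: less_induct)
  case less
  consider "lev x = 0" | "lev x = 1" | n where "lev x = Suc (Suc n)"
    by (metis One_nat_def not0_implies_Suc)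
  then show ?case
  proof cases
    case 1
    then show ?thesis using less.prems lev_eq_0_iff by auto
  next
    case 2
    then show ?thesis using less.prems root by (auto simp: arc_iff)
  next
    case (3 n)
    from lower[OF less.prems this] obtain y where y: "y \<in> V" "lev y = Suc n" "br y = br x"
      by blast
    have "(u, y) \<in> E ^^ Suc n"
      using less.hyps[of y] y 3 by simp
    moreover have "(y, x) \<in> E"
      using y 3 less.prems by (simp add: arc_iff)
    ultimately show ?thesis
      unfolding 3 by (rule relpow_Suc_I)
  qed
qed

lemma rdist_root: "x \<in> V \<Longrightarrow> rdist E u x = lev x"
  using relpow_root lev_lipschitz[of u x] by (intro rdist_eqI) auto

text \<open>
  A walk between different branches passes through the root. The proof measures it by the level taken
  with a positive sign in the branch of \<open>y\<close> and with a negative sign elsewhere: this changes by at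
  most one along an arc, and rises from \<open>- lev x\<close> to \<open>lev y\<close>.
\<close>

lemma lev_add_le:
  assumes "x \<noteq> u" "y \<noteq> u" "br x \<noteq> br y" "(x, y) \<in> E ^^ n"
  shows "lev x + lev y \<le> n"
proof -
  define \<phi> where "\<phi> z = (if z \<noteq> u \<and> br z = br y then int (lev z) else - int (lev z))" for z
  have "\<phi> b \<le> \<phi> a + 1" if "(a, b) \<in> E" for a b
    using that by (auto simp: \<phi>_def arc_iff split: if_splits)
  from relpow_potential_le[of E \<phi>, OF this assms(4)] show ?thesis
    using assms(1-3) by (simp add: \<phi>_def)
qed

text \<open>
  The root is in the middle if \<open>x\<close> and \<open>y\<close> lie in different branches, or both on the first level of
  one branch; otherwise the vertex of smaller level is.
\<close>

lemma collinear:
  assumes "x \<in> V" "y \<in> V" "x \<noteq> u" "y \<noteq> u" "x \<noteq> y"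
  shows "collinear E u x y"
proof -
  have root: "(u, x) \<in> E ^^ lev x" "(u, y) \<in> E ^^ lev y" "(x, u) \<in> E ^^ lev x" "(y, u) \<in> E ^^ lev y"
    using assms relpow_root relpow_sym[OF sym_E] by blast+
  have via: "(x, y) \<in> E ^^ (lev x + lev y)"
    using root by (intro relpow_trans)
  consider "br x \<noteq> br y" | "br x = br y" "lev x = lev y" | "br x = br y" "lev x < lev y"
    | "br x = br y" "lev y < lev x" by linarith
  then show ?thesis
  proof cases
    case 1
    then have "rdist E x y = lev x + lev y"
      using assms by (intro rdist_eqI via lev_add_le)
    then have "between E x u y"
      unfolding between_def using root by blast
    then show ?thesis by (simp add: collinear_def)
  next
    case 2
    then have l: "lev x = 1"
      using thin assms by blast
    have "2 \<le> n" if n: "(x, y) \<in> E ^^ n" for n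
    proof (rule ccontr)
      assume "\<not> 2 \<le> n"
      then have "n = 0 \<or> n = 1" by auto
      with n assms 2 show False by (auto simp: arc_iff)
    qed
    moreover have "lev x + lev y = 2"
      using 2 l by simp
    ultimately have "rdist E x y = lev x + lev y"
      using via by (intro rdist_eqI) simp_all
    then have "between E x u y"
      unfolding between_def using root by blast
    then show ?thesis by (simp add: collinear_def)
  next
    case 3
    then obtain n where n: "lev y = lev x + Suc n"
      using less_imp_Suc_add by auto
    then have "(x, y) \<in> E ^^ Suc n"
      using 3 assms lev_eq_0_iff by (intro relpow_climb) auto
    then have "between E u x y"
      unfolding between_def using root n rdist_root assms by metis
    then show ?thesis by (simp add: collinear_def)
  next
    case 4
    then obtain n where n: "lev x = lev y + Suc n"
      using less_imp_Suc_add by auto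
    then have "(y, x) \<in> E ^^ Suc n"
      using 4 assms lev_eq_0_iff by (intro relpow_climb) auto
    then have "between E u y x"
      unfolding between_def using root n rdist_root assms by metis
    then show ?thesis by (simp add: collinear_def)
  qed
qed

end

lemma branching_transport:
  assumes "branching V E u lev br" and f: "bij_betw f V V'"
    and E': "E' \<subseteq> V' \<times> V'" "\<And>x y. x \<in> V \<Longrightarrow> y \<in> V \<Longrightarrow> (f x, f y) \<in> E' \<longleftrightarrow> (x, y) \<in> E"
  shows "branching V' E' (f u) (lev \<circ> inv_into V f) (br \<circ> inv_into V f)"
proof -
  interpret branching V E u lev br by fact
  let ?g = "inv_into V f"
  have V': "V' = f ` V"
    using f by (auto simp: bij_betw_def)
  have inj: "f x = f y \<longleftrightarrow> x = y" if "x \<in> V" "y \<in> V" for x y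
    using f that by (auto simp: bij_betw_def inj_on_def)
  have g [simp]: "?g (f x) = x" if "x \<in> V" for x
    using f that by (auto simp: bij_betw_def)
  show ?thesis
  proof
    show "f u \<in> V'" using root V' by blast
  next
    fix x assume "x \<in> V'"
    then show "(lev \<circ> ?g) x = 0 \<longleftrightarrow> x = f u"
      using V' lev_eq_0_iff root inj by auto
  next
    fix x y
    show "(x, y) \<in> E' \<longleftrightarrow> x \<in> V' \<and> y \<in> V'
      \<and> ((lev \<circ> ?g) y = Suc ((lev \<circ> ?g) x) \<or> (lev \<circ> ?g) x = Suc ((lev \<circ> ?g) y))
      \<and> (x = f u \<or> y = f u \<or> (br \<circ> ?g) x = (br \<circ> ?g) y)"
    proof (cases "x \<in> V' \<and> y \<in> V'")
      case True
      then obtain a b where "x = f a" "a \<in> V" "y = f b" "b \<in> V"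
        using V' by blast
      then show ?thesis
        using E'(2)[of a b] arc_iff[of a b] inj root True by simp
    qed (use E'(1) in auto)
  next
    fix x n assume "x \<in> V'" "(lev \<circ> ?g) x = Suc (Suc n)"
    then obtain a where a: "x = f a" "a \<in> V" "lev a = Suc (Suc n)"
      using V' by auto
    from lower[OF this(2,3)] obtain b where "b \<in> V" "lev b = Suc n" "br b = br a"
      by blast
    then show "\<exists>y\<in>V'. (lev \<circ> ?g) y = Suc n \<and> (br \<circ> ?g) y = (br \<circ> ?g) x"
      using V' a by (intro bexI[of _ "f b"]) auto
  next
    fix x y assume "x \<in> V'" "y \<in> V'" "x \<noteq> y" "(lev \<circ> ?g) x = (lev \<circ> ?g) y"
      "(br \<circ> ?g) x = (br \<circ> ?g) y"
    moreover from this obtain a b where a: "x = f a" "a \<in> V" "y = f b" "b \<in> V"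
      using V' by blast
    ultimately have "a \<noteq> b" "lev a = lev b" "br a = br b"
      by auto
    from thin[OF a(2,4) this] obtain z where "lev a = 1" "z \<in> V" "br z = br a" "lev z = 2"
      by blast
    then show "(lev \<circ> ?g) x = 1 \<and> (\<exists>z\<in>V'. (br \<circ> ?g) z = (br \<circ> ?g) x \<and> (lev \<circ> ?g) z = 2)"
      using V' a by (auto intro!: bexI[of _ "f z"])
  qed
qed

text \<open>
  A bijection between branching structures preserves arcs as soon as it respects roots, levels and
  the equality of branches.
\<close>

lemma branching_arcs_eq:
  assumes "branching V E u lev br" "branching V' E' (g u) lev' br'"
    and g: "bij_betw g V V'"
    and lev': "\<And>x. x \<in> V \<Longrightarrow> lev' (g x) = lev x"
    and br': "\<And>x y. x \<in> V - {u} \<Longrightarrow> y \<in> V - {u} \<Longrightarrow> br' (g x) = br' (g y) \<longleftrightarrow> br x = br y"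
    and xy: "x \<in> V" "y \<in> V"
  shows "(g x, g y) \<in> E' \<longleftrightarrow> (x, y) \<in> E"
proof -
  interpret X: branching V E u lev br by fact
  interpret Y: branching V' E' "g u" lev' br' by fact
  have "g x \<in> V'" "g y \<in> V'" "g x = g u \<longleftrightarrow> x = u" "g y = g u \<longleftrightarrow> y = u"
    using g xy X.root by (auto simp: bij_betw_def inj_on_def)
  then show ?thesis
    using xy lev' br'[of x y] by (auto simp: X.arc_iff Y.arc_iff)
qed

section \<open>A vertex collinear with every pair\<close>

locale collinear_root =
  fixes V :: "'a set" and E :: "'a rel" and u :: 'a
  assumes E_subset: "E \<subseteq> V \<times> V" and sym_E: "sym E" and no_loop: "(x, x) \<notin> E"
    and root: "u \<in> V" and reach: "x \<in> V \<Longrightarrow> (u, x) \<in> E\<^sup>*"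
    and collinear: "x \<in> V \<Longrightarrow> y \<in> V \<Longrightarrow> x \<noteq> u \<Longrightarrow> y \<noteq> u \<Longrightarrow> x \<noteq> y \<Longrightarrow> collinear E u x y"
begin

abbreviation d :: "'a \<Rightarrow> 'a \<Rightarrow> nat" where "d \<equiv> rdist E"

definition lev :: "'a \<Rightarrow> nat" where "lev x = d u x"

text \<open>The component of \<open>x\<close> in the graph without \<open>u\<close>.\<close>

definition br :: "'a \<Rightarrow> 'a set" where "br x = (E \<inter> (V - {u}) \<times> (V - {u}))\<^sup>* `` {x}"

lemma reach2: "x \<in> V \<Longrightarrow> y \<in> V \<Longrightarrow> (x, y) \<in> E\<^sup>*"
  using reach sym_E by (meson rtrancl_trans symD sym_rtrancl)

lemma walk: "x \<in> V \<Longrightarrow> y \<in> V \<Longrightarrow> (x, y) \<in> E ^^ d x y"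
  by (intro rdist_relpow reach2)

lemma triangle: "x \<in> V \<Longrightarrow> y \<in> V \<Longrightarrow> z \<in> V \<Longrightarrow> d x z \<le> d x y + d y z"
  by (meson rdist_le relpow_trans walk)

lemma d_self [simp]: "d x x = 0"
  by (intro rdist_eqI) auto

lemma d_eq_0: "x \<in> V \<Longrightarrow> y \<in> V \<Longrightarrow> d x y = 0 \<longleftrightarrow> x = y"
  using walk[of x y] by auto

lemma d_commute: "d x y = d y x"
  by (rule rdist_commute[OF sym_E])

lemma d_arc:
  assumes "(x, y) \<in> E"
  shows "d x y = 1"
proof (rule rdist_eqI)
  have "x \<noteq> y" using assms no_loop by blast
  then show "1 \<le> m" if "(x, y) \<in> E ^^ m" for m
    using that by (cases m) auto
qed (use assms in simp)

lemma lev_root [simp]: "lev u = 0"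
  by (simp add: lev_def)

lemma lev_eq_0_iff: "x \<in> V \<Longrightarrow> lev x = 0 \<longleftrightarrow> x = u"
  unfolding lev_def using d_eq_0 root by auto

text \<open>
  The three cases are those of which of \<open>u\<close>, \<open>x\<close>, \<open>y\<close> is in the middle.
\<close>

lemma d_cases:
  assumes "x \<in> V" "y \<in> V" "x \<noteq> u" "y \<noteq> u" "x \<noteq> y"
  shows "d x y = lev x + lev y \<or> lev x < lev y \<and> d x y = lev y - lev x
    \<or> lev y < lev x \<and> d x y = lev x - lev y"
proof -
  have "d x y \<noteq> 0" using assms d_eq_0 by blast
  moreover have "d x y = lev x + lev y \<or> lev y = lev x + d x y \<or> lev x = lev y + d x y"
    using collinear[OF assms] unfolding collinear_def lev_def
    by (metis between_rdist d_commute)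
  ultimately show ?thesis by auto
qed

lemma arc_lev:
  assumes "(x, y) \<in> E"
  shows "lev y = Suc (lev x) \<or> lev x = Suc (lev y)"
proof -
  have V: "x \<in> V" "y \<in> V" and ne: "x \<noteq> y"
    using assms E_subset no_loop by auto
  show ?thesis
  proof (cases "x = u \<or> y = u")
    case True
    then show ?thesis
      using d_arc[OF assms] by (auto simp: lev_def d_commute)
  next
    case False
    then have "lev x \<noteq> 0" "lev y \<noteq> 0"
      using V lev_eq_0_iff by auto
    with d_cases[of x y] V False ne d_arc[OF assms] show ?thesis
      by auto
  qed
qed

text \<open>
  Vertices of the same level are at distance twice the level, vertices with a common neighbour at
  distance at most two.
\<close>

lemma no_common_neighbour:
  assumes "(x, t) \<in> E" "(y, t) \<in> E" "x \<noteq> y" "lev x = lev y"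
  shows "lev x \<le> 1"
proof (cases "x = u \<or> y = u")
  case False
  have V: "x \<in> V" "y \<in> V" "t \<in> V"
    using assms E_subset by auto
  have "d x y \<le> 2"
    using triangle[of x t y] d_arc[OF assms(1)] d_arc[OF assms(2)] V by (simp add: d_commute)
  then show ?thesis
    using d_cases[of x y] V False assms(3,4) by auto
qed (use assms(4) in auto)

lemma last_arc:
  assumes "x \<in> V" "y \<in> V" "d x y = Suc n"
  obtains z where "(z, y) \<in> E" "d x z \<le> n"
proof -
  have "(x, y) \<in> E ^^ Suc n"
    using walk assms by metis
  then obtain z where "(x, z) \<in> E ^^ n" "(z, y) \<in> E"
    by auto
  then show thesis by (intro that) (auto intro: rdist_le)
qed

text \<open>
  How two vertices of one branch can lie to each other. By \<open>d_cases\<close> the second alternative says that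
  the distance is the difference of the levels.
\<close>

definition close :: "'a \<Rightarrow> 'a \<Rightarrow> bool" where
  "close x y \<longleftrightarrow> x = y \<or> d x y < lev x + lev y \<or>
     lev x = 1 \<and> lev y = 1 \<and> (\<exists>t. lev t = 2 \<and> (x, t) \<in> E \<and> (y, t) \<in> E)"

text \<open>
  This carries \<open>close\<close> through a branch. By the triangle inequality the step from \<open>y\<close> to \<open>z\<close> can lead
  out of the second alternative only if \<open>x\<close> has level one and \<open>z\<close> lies below \<open>y\<close>. Then \<open>z\<close> is
  compared with the vertex \<open>w\<close> before \<open>y\<close> on a shortest walk from \<open>x\<close>: they have the same level and
  the common neighbour \<open>y\<close>. Above level one this forces \<open>z = w\<close>, which is close to \<open>x\<close>; on level one
  \<open>w\<close> is \<open>x\<close> itself, and \<open>y\<close> is the common neighbour in the third alternative.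
\<close>

lemma close_step:
  assumes "close x y" "x \<in> V" "x \<noteq> u" "(y, z) \<in> E" "y \<noteq> u" "z \<noteq> u"
  shows "close x z"
proof (cases "x = z")
  case ne: False
  have V: "y \<in> V" "z \<in> V"
    using assms E_subset by auto
  have pos: "lev x \<ge> 1" "lev y \<ge> 1" "lev z \<ge> 1"
    using V assms lev_eq_0_iff by (auto simp: Suc_le_eq)
  have yz: "d y z = 1"
    using assms d_arc by blast
  have zy: "(z, y) \<in> E"
    using assms sym_E by (meson symD)
  consider "x = y" | t where "lev x = 1" "lev y = 1" "lev t = 2" "(x, t) \<in> E" "(y, t) \<in> E"
    | "x \<noteq> y" "d x y < lev x + lev y"
    using assms(1) by (auto simp: close_def)
  then show ?thesis
  proof cases
    case 1
    then show ?thesis using yz pos by (auto simp: close_def)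
  next
    case 2
    then have "lev z = 2"
      using arc_lev[OF assms(4)] pos by auto
    then have "z = t"
      using no_common_neighbour[OF zy, of t] 2 sym_E by (force dest: symD)
    then show ?thesis
      using d_arc[OF 2(4)] pos by (auto simp: close_def)
  next
    case 3
    have xz: "d x z \<le> d x y + 1"
      using triangle[of x y z] yz V assms(2) by simp
    from arc_lev[OF assms(4)] show ?thesis
    proof
      assume "lev z = Suc (lev y)"
      with xz 3 show ?thesis by (simp add: close_def)
    next
      assume down: "lev y = Suc (lev z)"
      consider "d x y = lev x - lev y" "lev y < lev x" | "d x y = lev y - lev x" "lev x < lev y"
        using d_cases[OF assms(2) V(1) assms(3,5) 3(1)] 3(2) by linarith
      then show ?thesis
      proof cases
        case 1
        with xz down pos have "d x z < lev x + lev z" by linarith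
        then show ?thesis by (simp add: close_def)
      next
        case 2
        show ?thesis
        proof (cases "lev x = 1")
          case False
          with 2 xz down pos have "d x z < lev x + lev z" by linarith
          then show ?thesis by (simp add: close_def)
        next
          case True
          with 2 down pos have "d x y = Suc (lev z - 1)"
            by simp
          from last_arc[OF assms(2) V(1) this] obtain w where
            w: "(w, y) \<in> E" "d x w \<le> lev z - 1" .
          have "w \<in> V" using w(1) E_subset by auto
          then have "lev w \<le> lev z"
            using triangle[of u x w] root assms(2) True w(2) pos by (simp add: lev_def)
          then have lw: "lev w = lev z"
            using arc_lev[OF w(1)] down by auto
          show ?thesis
          proof (cases "lev z = 1")
            case True
            then have "w = x"
              using w(2) d_eq_0[of x w] assms(2) \<open>w \<in> V\<close> by simp
            then show ?thesis
              using True lw down w(1) zy by (auto simp: close_def)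
          next
            case False
            then have "w = z"
              using no_common_neighbour[OF w(1) zy] lw pos by auto
            with w(2) have "d x z \<le> lev z - 1" by simp
            with pos have "d x z < lev x + lev z" by linarith
            then show ?thesis by (simp add: close_def)
          qed
        qed
      qed
    qed
  qed
qed (simp add: close_def)

lemma branch_close:
  assumes "x \<in> V" "y \<in> V" "x \<noteq> u" "y \<noteq> u" "br x = br y"
  shows "close x y"
proof -
  have "(x, y) \<in> (E \<inter> (V - {u}) \<times> (V - {u}))\<^sup>*"
    using assms(5) unfolding br_def by blast
  then show ?thesis
  proof (induction rule: rtrancl_induct)
    case base
    show ?case by (simp add: close_def)
  next
    case (step y z)
    then show ?case using close_step assms by auto
  qed
qed

lemma arc_branch:
  assumes "(x, y) \<in> E" "x \<noteq> u" "y \<noteq> u"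
  shows "br x = br y"
proof -
  let ?R = "E \<inter> (V - {u}) \<times> (V - {u})"
  have "(x, y) \<in> ?R" "(y, x) \<in> ?R"
    using assms E_subset sym_E by (auto dest: symD)
  then show ?thesis
    unfolding br_def by (auto intro: converse_rtrancl_into_rtrancl)
qed

text \<open>
  Vertices of one branch are close. For consecutive levels closeness means adjacency, and for equal
  levels it leaves only the alternative of two vertices of level one with a common neighbour.
\<close>

lemma branching: "branching V E u lev br"
proof
  show "u \<in> V" by (rule root)
  show "lev x = 0 \<longleftrightarrow> x = u" if "x \<in> V" for x
    using that by (rule lev_eq_0_iff)
next
  fix x y
  show "(x, y) \<in> E \<longleftrightarrow> x \<in> V \<and> y \<in> V \<and> (lev y = Suc (lev x) \<or> lev x = Suc (lev y))
      \<and> (x = u \<or> y = u \<or> br x = br y)" (is "_ \<longleftrightarrow> ?R")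
  proof
    assume "(x, y) \<in> E"
    then show ?R
      using E_subset arc_lev arc_branch by blast
  next
    assume R: ?R
    have "d x y = 1"
    proof (cases "x = u \<or> y = u")
      case True
      then show ?thesis
        using R by (auto simp: lev_def d_commute)
    next
      case False
      then have "close x y" "x \<noteq> y"
        using R branch_close by auto
      then have "d x y < lev x + lev y"
        using R by (auto simp: close_def)
      then show ?thesis
        using d_cases[of x y] R False \<open>x \<noteq> y\<close> by auto
    qed
    then show "(x, y) \<in> E"
      using walk[of x y] R by simp
  qed
next
  fix x n
  assume x: "x \<in> V" "lev x = Suc (Suc n)"
  then have "d u x = Suc (Suc n)" by (simp add: lev_def)
  from last_arc[OF root x(1) this] obtain y where y: "(y, x) \<in> E" "lev y \<le> Suc n"
    unfolding lev_def .
  then have "lev y = Suc n"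
    using arc_lev[OF y(1)] x(2) by auto
  moreover have "x \<noteq> u" "y \<noteq> u"
    using x(2) \<open>lev y = Suc n\<close> by auto
  ultimately show "\<exists>y\<in>V. lev y = Suc n \<and> br y = br x"
    using arc_branch[OF y(1)] y(1) E_subset by blast
next
  fix x y
  assume x: "x \<in> V" "y \<in> V" "x \<noteq> y" "lev x = lev y" "br x = br y"
  then have ne: "x \<noteq> u" "y \<noteq> u"
    using lev_eq_0_iff lev_root by metis+
  then have "\<not> d x y < lev x + lev y"
    using d_cases[of x y] x by auto
  then obtain t where t: "lev x = 1" "lev t = 2" "(x, t) \<in> E"
    using branch_close[OF x(1,2) ne x(5)] x(3) by (auto simp: close_def)
  then have "t \<noteq> u" by auto
  then show "lev x = 1 \<and> (\<exists>z\<in>V. br z = br x \<and> lev z = 2)"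
    using t arc_branch[OF t(3) ne(1)] E_subset by auto
qed

end

section \<open>The graphs of the family\<close>

lemma set_vwalk_arcs_map_upt:
  "set (vwalk_arcs (map f [0..<n])) = {(f t, f (Suc t)) |t. Suc t < n}"
proof (induction n)
  case (Suc n)
  show ?case
  proof (cases "n = 0")
    case False
    then have "set (vwalk_arcs (map f [0..<Suc n])) = insert (f (n - 1), f n) {(f t, f (Suc t)) |t. Suc t < n}"
      using Suc by (simp add: set_vwalk_arcs_snoc last_map)
    also have "\<dots> = {(f t, f (Suc t)) |t. Suc t < Suc n}"
      using False by (auto simp: less_Suc_eq)
    finally show ?thesis .
  qed simp
qed simp

fun \<H>_lev :: "\<H>_vertex \<Rightarrow> nat" where
  "\<H>_lev Hub = 0"
| "\<H>_lev (Mid i j) = 1"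
| "\<H>_lev (Tail i t) = Suc (Suc t)"
| "\<H>_lev (Leg j t) = Suc t"

fun \<H>_br :: "\<H>_vertex \<Rightarrow> nat + nat" where
  "\<H>_br Hub = Inl 0"
| "\<H>_br (Mid i j) = Inl i"
| "\<H>_br (Tail i t) = Inl i"
| "\<H>_br (Leg j t) = Inr j"

lemma pverts_\<H>_graph:
  "pverts (\<H>_graph k n l p m) = {Hub} \<union> {Mid i j |i j. i < k \<and> j < n i}
     \<union> {Tail i t |i t. i < k \<and> t \<le> l i} \<union> {Leg j t |j t. j < p \<and> t < m j}"
  by (auto simp: \<H>_graph_def graph_Union_def path_graph_def complete_bipartite_on_def less_Suc_eq_le
      simp del: upt_Suc)

lemma parcs_\<H>_graph:
  "parcs (\<H>_graph k n l p m) = (let A =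
       {(Hub, Mid i j) |i j. i < k \<and> j < n i} \<union> {(Mid i j, Tail i 0) |i j. i < k \<and> j < n i}
     \<union> {(Tail i t, Tail i (Suc t)) |i t. i < k \<and> t < l i}
     \<union> {(Hub, Leg j 0) |j. j < p \<and> 0 < m j} \<union> {(Leg j t, Leg j (Suc t)) |j t. j < p \<and> Suc t < m j}
     in A \<union> A\<inverse>)"
proof -
  have leg: "set (vwalk_arcs (Hub # map (Leg j) [0..<m j])) =
      {e. e = (Hub, Leg j 0) \<and> 0 < m j} \<union> {(Leg j t, Leg j (Suc t)) |t. Suc t < m j}" for j
  proof (cases "m j = 0")
    case False
    then have "hd (map (Leg j) [0..<m j]) = Leg j 0" "map (Leg j) [0..<m j] \<noteq> []"
      by (auto simp: hd_map)
    then show ?thesis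
      using False by (auto simp: set_vwalk_arcs_map_upt)
  qed simp
  show ?thesis
    unfolding \<H>_graph_def graph_Union_def path_graph_def complete_bipartite_on_def
    by (simp only: image_Un image_image UN_Un pair_pre_digraph.simps leg set_vwalk_arcs_map_upt Let_def
        Suc_less_eq image_insert image_empty UN_insert UN_empty vwalk_arcs.simps) auto
qed

lemma branching_\<H>_graph:
  assumes "\<And>i. i < k \<Longrightarrow> n i \<ge> 1"
  shows "branching (pverts (\<H>_graph k n l p m)) (parcs (\<H>_graph k n l p m)) Hub \<H>_lev \<H>_br"
    (is "branching ?V ?E _ _ _")
proof
  show "Hub \<in> ?V" by (simp add: pverts_\<H>_graph)
  show "\<H>_lev x = 0 \<longleftrightarrow> x = Hub" for x by (cases x) auto
  show "(x, y) \<in> ?E \<longleftrightarrow> x \<in> ?V \<and> y \<in> ?V \<and> (\<H>_lev y = Suc (\<H>_lev x) \<or> \<H>_lev x = Suc (\<H>_lev y))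
      \<and> (x = Hub \<or> y = Hub \<or> \<H>_br x = \<H>_br y)" for x y
    by (cases x; cases y) (auto simp: pverts_\<H>_graph parcs_\<H>_graph Let_def)
next
  fix x t assume x: "x \<in> ?V" "\<H>_lev x = Suc (Suc t)"
  show "\<exists>y\<in>?V. \<H>_lev y = Suc t \<and> \<H>_br y = \<H>_br x"
  proof (cases x)
    case (Tail i s)
    show ?thesis
    proof (cases s)
      case 0
      with Tail x assms[of i] show ?thesis
        by (intro bexI[of _ "Mid i 0"]) (auto simp: pverts_\<H>_graph)
    next
      case (Suc r)
      with Tail x show ?thesis
        by (intro bexI[of _ "Tail i r"]) (auto simp: pverts_\<H>_graph)
    qed
  next
    case (Leg j s)
    with x show ?thesis
      by (intro bexI[of _ "Leg j t"]) (auto simp: pverts_\<H>_graph)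
  qed (use x in auto)
next
  fix x y
  assume *: "x \<in> ?V" "y \<in> ?V" "x \<noteq> y" "\<H>_lev x = \<H>_lev y" "\<H>_br x = \<H>_br y"
  then obtain i j where x: "x = Mid i j"
    by (cases x; cases y) auto
  with *(1) have "Tail i 0 \<in> ?V"
    by (auto simp: pverts_\<H>_graph)
  with x show "\<H>_lev x = 1 \<and> (\<exists>z\<in>?V. \<H>_br z = \<H>_br x \<and> \<H>_lev z = 2)"
    by (auto intro!: bexI[of _ "Tail i 0"])
qed

section \<open>Isomorphisms with the graphs of the family\<close>

text \<open>
  The isomorphisms of the library also map arcs and carry their own end maps; between graphs whose
  arcs are pairs, all this is determined by the map of the vertices.
\<close>

lemma digraph_iso_iff_bij:
  assumes "pair_wf_digraph H" "pair_wf_digraph G"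
  shows "digraph_iso (with_proj H) (with_proj G) \<longleftrightarrow> (\<exists>f. bij_betw f (pverts H) (pverts G) \<and>
    (\<forall>x\<in>pverts H. \<forall>y\<in>pverts H. (f x, f y) \<in> parcs G \<longleftrightarrow> (x, y) \<in> parcs H))" (is "?L \<longleftrightarrow> ?R")
proof -
  interpret H: pair_wf_digraph H by fact
  interpret G: pair_wf_digraph G by fact
  have wfH: "fst e \<in> pverts H" "snd e \<in> pverts H" if "e \<in> parcs H" for e
    using that H.arc_fst_in_verts H.arc_snd_in_verts by auto
  show ?thesis
  proof
    assume ?L
    then obtain h where iso: "H.digraph_isomorphism h" and G: "with_proj G = app_iso h (with_proj H)"
      by (auto simp: digraph_iso_def)
    define f where "f = iso_verts h"
    from G have ends: "iso_tail h = fst" "iso_head h = snd"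
      and GV: "pverts G = f ` pverts H" and GE: "parcs G = iso_arcs h ` parcs H"
      by (auto simp: with_proj_def app_iso_def f_def)
    have inj: "inj_on f (pverts H)"
      and arc: "\<And>e. e \<in> parcs H \<Longrightarrow> iso_arcs h e = (f (fst e), f (snd e))"
      using iso ends by (auto simp: H.digraph_isomorphism_def f_def prod_eq_iff)
    have "(f x, f y) \<in> parcs G \<longleftrightarrow> (x, y) \<in> parcs H" if xy: "x \<in> pverts H" "y \<in> pverts H" for x y
    proof
      assume "(f x, f y) \<in> parcs G"
      then obtain e where e: "e \<in> parcs H" "f (fst e) = f x" "f (snd e) = f y"
        using GE arc by auto
      then have "fst e = x" "snd e = y"
        using inj xy wfH by (auto dest: inj_onD)
      with e(1) show "(x, y) \<in> parcs H" by auto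
    qed (use GE arc in \<open>force simp: image_iff\<close>)
    with inj GV show ?R
      by (auto simp: bij_betw_def)
  next
    assume ?R
    then obtain f where f: "bij_betw f (pverts H) (pverts G)"
      "\<And>x y. x \<in> pverts H \<Longrightarrow> y \<in> pverts H \<Longrightarrow> (f x, f y) \<in> parcs G \<longleftrightarrow> (x, y) \<in> parcs H"
      by blast
    define h where "h = \<lparr>iso_verts = f, iso_arcs = map_prod f f, iso_head = snd, iso_tail = fst\<rparr>"
    have inj: "inj_on f (pverts H)" and GV: "pverts G = f ` pverts H"
      using f(1) by (auto simp: bij_betw_def)
    have "parcs G \<subseteq> map_prod f f ` parcs H"
    proof
      fix e assume e: "e \<in> parcs G"
      then have "fst e \<in> f ` pverts H" "snd e \<in> f ` pverts H"
        using GV G.arc_fst_in_verts G.arc_snd_in_verts by auto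
      then obtain x y where xy: "e = (f x, f y)" "x \<in> pverts H" "y \<in> pverts H"
        by (metis imageE prod.collapse)
      with e f(2) have "(x, y) \<in> parcs H" by auto
      with xy show "e \<in> map_prod f f ` parcs H" by force
    qed
    moreover have "map_prod f f ` parcs H \<subseteq> parcs G"
      using f(2) wfH by force
    ultimately have "with_proj G = app_iso h (with_proj H)"
      using GV by (auto simp: with_proj_def app_iso_def h_def)
    moreover have "inj_on (map_prod f f) (parcs H)"
    proof (rule inj_onI)
      fix e e' assume "e \<in> parcs H" "e' \<in> parcs H" "map_prod f f e = map_prod f f e'"
      then show "e = e'"
        using wfH inj_onD[OF inj] by (cases e, cases e') force
    qed
    then have "H.digraph_isomorphism h"
      using inj by (auto simp: H.digraph_isomorphism_def h_def H.wf_digraph_axioms)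
    ultimately show ?L
      unfolding digraph_iso_def by blast
  qed
qed

lemma (in branching) pair_wf: "V = pverts H \<Longrightarrow> E = parcs H \<Longrightarrow> pair_wf_digraph H"
proof unfold_locales
  fix e assume "V = pverts H" "E = parcs H" "e \<in> parcs H"
  then show "fst e \<in> pverts H" "snd e \<in> pverts H"
    using arc_iff[of "fst e" "snd e"] by simp_all
qed

context branching
begin

lemma lower_levels:
  assumes "x \<in> V" "1 \<le> t" "t \<le> lev x"
  shows "\<exists>y\<in>V. lev y = t \<and> br y = br x"
  using assms(1,3)
proof (induction "lev x" arbitrary: x rule: less_induct)
  case less
  show ?case
  proof (cases "t = lev x")
    case False
    with less.prems assms(2) have "2 \<le> lev x" by linarith
    then obtain s where s: "lev x = Suc (Suc s)"
      by (metis add_2_eq_Suc le_Suc_ex)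
    from lower[OF less.prems(1) s] obtain y where y: "y \<in> V" "lev y = Suc s" "br y = br x"
      by blast
    with less.hyps[of y] less.prems s False show ?thesis by auto
  qed (use less.prems in blast)
qed

text \<open>
  A branch with at least two vertices of level one (collected in \<open>T\<close>) becomes a complete bipartite
  graph with its pendant path, each other branch (collected in \<open>Q\<close>) a path attached at the hub.
  Branches of each kind are numbered, and so are the vertices of level one in a branch of \<open>T\<close>;
  every other vertex is located by its branch and its level, because \<open>thin\<close> makes it unique there. No
  level up to the height of the branch is left out, so the numbering fills the whole graph.
\<close>

lemma bij_\<H>_graph:
  assumes fin: "finite V"
  obtains k n l p m g where
    "\<forall>i<k. n i \<ge> 2" "bij_betw g V (pverts (\<H>_graph k n l p m))" "g u = Hub"
    "\<And>x. x \<in> V \<Longrightarrow> \<H>_lev (g x) = lev x"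
    "\<And>x y. x \<in> V - {u} \<Longrightarrow> y \<in> V - {u} \<Longrightarrow> \<H>_br (g x) = \<H>_br (g y) \<longleftrightarrow> br x = br y"
proof -
  define M where "M b = {x \<in> V. lev x = 1 \<and> br x = b}" for b
  define height where "height b = Max (lev ` {x \<in> V - {u}. br x = b})" for b
  define T where "T = {b \<in> br ` (V - {u}). 2 \<le> card (M b)}"
  define Q where "Q = br ` (V - {u}) - T"
  have finM: "finite (M b)" for b
    using fin by (simp add: M_def)
  have finTQ: "finite T" "finite Q"
    using fin by (simp_all add: T_def Q_def)
  obtain e where e: "bij_betw e T {0..<card T}"
    using ex_bij_betw_finite_nat[OF finTQ(1)] by blast
  obtain e' where e': "bij_betw e' Q {0..<card Q}"
    using ex_bij_betw_finite_nat[OF finTQ(2)] by blast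
  obtain c where c: "\<And>b. bij_betw (c b) (M b) {0..<card (M b)}"
    using ex_bij_betw_finite_nat[OF finM] by metis
  define ti where "ti = inv_into T e"
  define qi where "qi = inv_into Q e'"
  have ti: "ti (e b) = b" "e b < card T" if "b \<in> T" for b
    using e that bij_betwE[OF e] by (auto simp: ti_def bij_betw_def)
  have qi: "qi (e' b) = b" "e' b < card Q" if "b \<in> Q" for b
    using e' that bij_betwE[OF e'] by (auto simp: qi_def bij_betw_def)
  have ti': "ti i \<in> T" "e (ti i) = i" if "i < card T" for i
    using e that by (auto simp: ti_def bij_betw_def inv_into_into f_inv_into_f)
  have qi': "qi i \<in> Q" "e' (qi i) = i" if "i < card Q" for i
    using e' that by (auto simp: qi_def bij_betw_def inv_into_into f_inv_into_f)

  have le_height: "lev x \<le> height (br x)" if "x \<in> V - {u}" for x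
    unfolding height_def using fin that by (intro Max_ge) auto
  have at_level: "\<exists>x\<in>V - {u}. br x = b \<and> lev x = t"
    if "b \<in> T \<union> Q" "1 \<le> t" "t \<le> height b" for b t
  proof -
    have "{x \<in> V - {u}. br x = b} \<noteq> {}"
      using that(1) by (auto simp: T_def Q_def)
    then have "height b \<in> lev ` {x \<in> V - {u}. br x = b}"
      unfolding height_def using fin by (intro Max_in) auto
    then obtain x where "x \<in> V" "br x = b" "lev x = height b"
      by auto
    with lower_levels[of x t] that(2,3) obtain y where "y \<in> V" "lev y = t" "br y = b"
      by auto
    with that(2) show ?thesis
      by (intro bexI[of _ y]) auto
  qed
  have height_T: "2 \<le> height b" if "b \<in> T" for b
  proof -
    have "\<not> card (M b) \<le> Suc 0"
      using that by (simp add: T_def)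
    then obtain x y where "x \<in> M b" "y \<in> M b" "x \<noteq> y"
      using card_le_Suc0_iff_eq[OF finM] by blast
    then obtain z where "z \<in> V" "br z = b" "lev z = 2"
      using thin[of x y] by (auto simp: M_def)
    then show ?thesis
      using le_height[of z] lev_root by force
  qed
  have unique: "x = y"
    if "x \<in> V - {u}" "y \<in> V - {u}" "br x = br y" "lev x = lev y" "lev x \<noteq> 1 \<or> br x \<notin> T" for x y
  proof (rule ccontr)
    assume ne: "x \<noteq> y"
    then have "lev x = 1"
      using thin[of x y] that by auto
    moreover from this have "x \<in> M (br x)" "y \<in> M (br x)"
      using that by (auto simp: M_def)
    then have "\<not> card (M (br x)) \<le> Suc 0"
      using card_le_Suc0_iff_eq[OF finM] ne by blast
    then have "br x \<in> T"
      using that(1) by (simp add: T_def)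
    ultimately show False
      using that(5) by blast
  qed

  define g where "g x = (if x = u then Hub
    else if br x \<in> T
      then (if lev x = 1 then Mid (e (br x)) (c (br x) x) else Tail (e (br x)) (lev x - 2))
    else Leg (e' (br x)) (lev x - 1))" for x
  \<comment> \<open>\<open>Tail i 0\<close> has level two and the first vertex of a leg has level one: hence the offsets.\<close>
  let ?H = "\<H>_graph (card T) (\<lambda>i. card (M (ti i))) (\<lambda>i. height (ti i) - 2) (card Q) (\<lambda>j. height (qi j))"
  have g_u: "g u = Hub" by (simp add: g_def)
  have g_lev: "\<H>_lev (g x) = lev x" if "x \<in> V" for x
  proof (cases "x = u")
    case False
    then have "lev x \<noteq> 0"
      using that lev_eq_0_iff by blast
    then show ?thesis
      using False by (auto simp: g_def)
  qed (simp add: g_def)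
  have g_br: "\<H>_br (g x) = (if br x \<in> T then Inl (e (br x)) else Inr (e' (br x)))" if "x \<noteq> u" for x
    using that by (simp add: g_def)
  have in_TQ: "br x \<in> T \<or> br x \<in> Q" if "x \<in> V - {u}" for x
    using that by (auto simp: Q_def)
  have g_br_eq: "\<H>_br (g x) = \<H>_br (g y) \<longleftrightarrow> br x = br y" if "x \<in> V - {u}" "y \<in> V - {u}" for x y
  proof -
    have "e (br x) = e (br y) \<Longrightarrow> br x = br y" if "br x \<in> T" "br y \<in> T"
      using ti(1) that by metis
    moreover have "e' (br x) = e' (br y) \<Longrightarrow> br x = br y" if "br x \<in> Q" "br y \<in> Q"
      using qi(1) that by metis
    ultimately show ?thesis
      using that in_TQ[of x] in_TQ[of y] by (auto simp: g_br)
  qed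
  have "inj_on g V"
  proof (rule inj_onI)
    fix x y assume xy: "x \<in> V" "y \<in> V" "g x = g y"
    then have lev: "lev x = lev y"
      using g_lev by metis
    show "x = y"
    proof (cases "x = u \<or> y = u")
      case True
      then show ?thesis
        using lev xy lev_eq_0_iff lev_root by metis
    next
      case False
      then have br: "br x = br y"
        using g_br_eq[of x y] xy by simp
      show ?thesis
      proof (cases "lev x = 1 \<and> br x \<in> T")
        case True
        then have "x \<in> M (br x)" "y \<in> M (br x)" "c (br x) x = c (br x) y"
          using xy lev br False by (auto simp: M_def g_def)
        then show ?thesis
          using c[of "br x"] by (auto simp: bij_betw_def dest: inj_onD)
      qed (use unique[of x y] xy False br lev in auto)
    qed
  qed
  moreover have "g ` V = pverts ?H"
  proof
    show "g ` V \<subseteq> pverts ?H"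
    proof
      fix z assume "z \<in> g ` V"
      then obtain x where x: "x \<in> V" "z = g x" by blast
      show "z \<in> pverts ?H"
      proof (cases "x = u")
        case False
        then have pos: "lev x \<noteq> 0" and h: "lev x \<le> height (br x)"
          using x lev_eq_0_iff le_height by auto
        show ?thesis
        proof (cases "br x \<in> T")
          case True
          show ?thesis
          proof (cases "lev x = 1")
            case l: True
            then have "x \<in> M (br x)"
              using x by (simp add: M_def)
            then have "c (br x) x < card (M (br x))"
              using bij_betwE[OF c] by auto
            then show ?thesis
              using x(2) False True l ti[OF True] by (simp add: g_def pverts_\<H>_graph)
          next
            case l: False
            then show ?thesis
              using x(2) False True h ti[OF True] by (simp add: g_def pverts_\<H>_graph)
          qed
        next
          case nT: False
          then have "br x \<in> Q"
            using in_TQ[of x] x(1) False by simp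
          moreover from pos h have "lev x - 1 < height (br x)" by linarith
          ultimately show ?thesis
            using x(2) False nT qi[of "br x"] by (simp add: g_def pverts_\<H>_graph)
        qed
      qed (simp add: x g_def pverts_\<H>_graph)
    qed
  next
    show "pverts ?H \<subseteq> g ` V"
    proof
      fix z assume z: "z \<in> pverts ?H"
      show "z \<in> g ` V"
      proof (cases z)
        case Hub
        then show ?thesis using g_u root by force
      next
        case (Mid i j)
        then have i: "i < card T" and j: "j < card (M (ti i))"
          using z by (auto simp: pverts_\<H>_graph)
        then have "j \<in> c (ti i) ` M (ti i)"
          using c[of "ti i"] by (simp add: bij_betw_def)
        then obtain x where x: "x \<in> M (ti i)" "c (ti i) x = j"
          by blast
        then have "g x = Mid i j"
          using ti'[OF i] by (auto simp: g_def M_def)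
        with x(1) Mid show ?thesis by (force simp: M_def)
      next
        case (Tail i t)
        then have i: "i < card T" and "t \<le> height (ti i) - 2"
          using z by (auto simp: pverts_\<H>_graph)
        then have "t + 2 \<le> height (ti i)"
          using height_T[OF ti'(1)[OF i]] by linarith
        with at_level[of "ti i" "t + 2"] ti'(1)[OF i]
        obtain x where x: "x \<in> V - {u}" "br x = ti i" "lev x = t + 2"
          by auto
        then have "g x = Tail i t"
          using ti'[OF i] by (simp add: g_def)
        with x(1) Tail show ?thesis by force
      next
        case (Leg j t)
        then have j: "j < card Q" and "t < height (qi j)"
          using z by (auto simp: pverts_\<H>_graph)
        with at_level[of "qi j" "t + 1"] qi'(1)[OF j]
        obtain x where x: "x \<in> V - {u}" "br x = qi j" "lev x = t + 1"
          by auto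
        then have "g x = Leg j t"
          using qi'[OF j] by (simp add: g_def Q_def)
        with x(1) Leg show ?thesis by force
      qed
    qed
  qed
  ultimately have "bij_betw g V (pverts ?H)"
    by (simp add: bij_betw_def)
  moreover have "\<forall>i<card T. 2 \<le> card (M (ti i))"
    using ti'(1) by (auto simp: T_def)
  ultimately show thesis
    using g_u g_lev g_br_eq by (intro that)
qed

end

context pair_graph
begin

lemma iso_\<H>_graph_branching:
  assumes "\<forall>i<k. n i \<ge> 2" "digraph_iso (\<H>_graph k n l p m) G"
  shows "\<exists>u lev br. branching (pverts G) (parcs G) u lev (br :: 'a \<Rightarrow> nat + nat)"
proof -
  let ?H = "\<H>_graph k n l p m"
  have H: "branching (pverts ?H) (parcs ?H) Hub \<H>_lev \<H>_br"
  proof (rule branching_\<H>_graph)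
    show "1 \<le> n i" if "i < k" for i
      using assms(1)[rule_format, OF that] by simp
  qed
  interpret H: branching "pverts ?H" "parcs ?H" Hub \<H>_lev \<H>_br by (rule H)
  have wf: "pair_wf_digraph ?H" "pair_wf_digraph G"
    using H.pair_wf pair_wf_digraph by auto
  obtain f where f: "bij_betw f (pverts ?H) (pverts G)"
    "\<forall>x\<in>pverts ?H. \<forall>y\<in>pverts ?H. (f x, f y) \<in> parcs G \<longleftrightarrow> (x, y) \<in> parcs ?H"
    using assms(2) unfolding digraph_iso_iff_bij[OF wf] by blast
  have "parcs G \<subseteq> pverts G \<times> pverts G"
    by (auto dest: in_arcsD1 in_arcsD2)
  from branching_transport[OF H f(1) this] f(2) show ?thesis by blast
qed

lemma branching_iso_\<H>_graph:
  assumes "branching (pverts G) (parcs G) u lev br"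
  shows "\<exists>k n l p m. (\<forall>i<k. n i \<ge> 2) \<and> digraph_iso (\<H>_graph k n l p m) G"
proof -
  interpret branching "pverts G" "parcs G" u lev br by fact
  obtain k n l p m g where n: "\<forall>i<k. n i \<ge> 2"
    and g: "bij_betw g (pverts G) (pverts (\<H>_graph k n l p m))" "g u = Hub"
    "\<And>x. x \<in> pverts G \<Longrightarrow> \<H>_lev (g x) = lev x"
    "\<And>x y. x \<in> pverts G - {u} \<Longrightarrow> y \<in> pverts G - {u} \<Longrightarrow> \<H>_br (g x) = \<H>_br (g y) \<longleftrightarrow> br x = br y"
    by (rule bij_\<H>_graph[OF pair_finite_verts]) (rule that)
  let ?H = "\<H>_graph k n l p m"
  have H: "branching (pverts ?H) (parcs ?H) (g u) \<H>_lev \<H>_br"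
    unfolding g(2)
  proof (rule branching_\<H>_graph)
    show "1 \<le> n i" if "i < k" for i
      using n[rule_format, OF that] by simp
  qed
  interpret H: branching "pverts ?H" "parcs ?H" "g u" \<H>_lev \<H>_br by (rule H)
  have wf: "pair_wf_digraph ?H" "pair_wf_digraph G"
    using H.pair_wf pair_wf_digraph by auto
  have arcs: "(g x, g y) \<in> parcs ?H \<longleftrightarrow> (x, y) \<in> parcs G" if "x \<in> pverts G" "y \<in> pverts G" for x y
    using branching_arcs_eq[OF assms H g(1,3,4) that] by blast
  let ?f = "inv_into (pverts G) g"
  have f: "bij_betw ?f (pverts ?H) (pverts G)"
    using g(1) by (rule bij_betw_inv_into)
  have "(?f x, ?f y) \<in> parcs G \<longleftrightarrow> (x, y) \<in> parcs ?H" if "x \<in> pverts ?H" "y \<in> pverts ?H" for x y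
    using arcs[of "?f x" "?f y"] that bij_betwE[OF f] bij_betw_inv_into_right[OF g(1)] by simp
  with f have "digraph_iso ?H G"
    unfolding digraph_iso_iff_bij[OF wf] by blast
  with n show ?thesis by blast
qed

text \<open>
  With a third vertex \<open>w\<close> available, collinearity of \<open>u\<close>, \<open>x\<close>, \<open>w\<close> places \<open>u\<close> and \<open>x\<close> on a common
  path. A graph with two vertices has no such triple, which is why it is assumed to be connected.
\<close>

lemma reachable_of_collinear:
  assumes "card (pverts G) \<ge> 2" "card (pverts G) = 2 \<longrightarrow> connected G" "u \<in> pverts G"
    and coll: "\<forall>v\<in>pverts G - {u}. \<forall>w\<in>pverts G - {u, v}. collinear (parcs G) u v w"
    and x: "x \<in> pverts G"
  shows "(u, x) \<in> (parcs G)\<^sup>*"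
proof (cases "card (pverts G) = 2 \<or> x = u")
  case True
  show ?thesis
  proof (cases "x = u")
    case False
    with True assms(2) have "connected G" by blast
    then have "strongly_connected (with_proj G)"
      by (intro symmetric_connected_imp_strongly_connected pair_sym_arcs)
    then have "u \<rightarrow>\<^sup>*\<^bsub>G\<^esub> x"
      using assms(3) x by (auto simp: strongly_connected_def)
    then show ?thesis
      unfolding reachable_def by (auto dest: rtrancl_on_rtranclI)
  qed simp
next
  case False
  have "\<not> pverts G \<subseteq> {u, x}"
  proof
    assume "pverts G \<subseteq> {u, x}"
    then have "card (pverts G) \<le> card {u, x}"
      by (intro card_mono) auto
    with False assms(1) show False by auto
  qed
  then obtain w where "w \<in> pverts G - {u, x}" by blast
  with coll x False have "collinear (parcs G) u x w" by auto
  then show ?thesis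
    by (rule collinear_reach[OF sym_parcs])
qed

end

theorem theorem3p2:
  fixes G :: "'a pair_pre_digraph"
  assumes "pair_graph G"
    and "card (pverts G) = 2 \<longrightarrow> connected G"
  shows "gp_game' G = 2 \<longleftrightarrow> in_\<H> G"
proof -
  interpret pair_graph G by fact
  show ?thesis
  proof
    assume "gp_game' G = 2"
    then obtain u where card: "card (pverts G) \<ge> 2" and u: "u \<in> pverts G"
      and coll: "\<forall>v\<in>pverts G - {u}. \<forall>w\<in>pverts G - {u, v}. collinear (parcs G) u v w"
      unfolding gp_game'_eq_2_iff_collinear by blast
    interpret collinear_root "pverts G" "parcs G" u
    proof
      show "parcs G \<subseteq> pverts G \<times> pverts G"
        by (auto dest: in_arcsD1 in_arcsD2)
      show "(x, x) \<notin> parcs G" for x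
        using no_loops' by blast
      show "(u, x) \<in> (parcs G)\<^sup>*" if "x \<in> pverts G" for x
        using reachable_of_collinear[OF card assms(2) u coll that] .
    qed (use u coll sym_parcs in auto)
    show "in_\<H> G"
      unfolding in_\<H>_def using card branching_iso_\<H>_graph[OF branching] by blast
  next
    assume "in_\<H> G"
    then obtain u lev and br :: "'a \<Rightarrow> nat + nat" where card: "card (pverts G) \<ge> 2"
      and "branching (pverts G) (parcs G) u lev br"
      unfolding in_\<H>_def using iso_\<H>_graph_branching by blast
    then interpret branching "pverts G" "parcs G" u lev br by blast
    show "gp_game' G = 2"
      unfolding gp_game'_eq_2_iff_collinear using card root collinear by auto
  qed
qed

end
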